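(* Let $k\ge 2$, let $0=r_0<r_1<\dots<r_k$ be integers, $d=\gcd(r_1,\dots,r_k)$, $S=\langle r_1,\dots,r_k\rangle$, and let $n\ge r_k^4$ be an integer with $\gcd(n,d)=1$. Let $M_n=\langle n,n+r_1,\dots,n+r_k\rangle$, let $f_1<f_2<\dots<f_t$ be the pseudo-Frobenius numbers of $M_n$, and let $f_p\equiv i_p\bmod n$ with $i_p\in\operatorname{Ap}(S,dn)$ for $1\le p\le t$. Then there exists an integer $0\le s\le t$ such that $i_p\in P_n'$ when $p\le s$ and $i_p\in P_n''$ when $p>s$. Moreover, $\varphi_n^\lambda(f_1)<\varphi_n^\lambda(f_2)<\dots<\varphi_n^\lambda(f_t)$ for every $\lambda\in\mathbb{N}$.
   Context: $\mathbb{N}$ includes $0$, and $\langle a_1,\dots,a_s\rangle=\{\sum\lambda_i a_i\mid\lambda_i\in\mathbb{N}\}$. For a numerical semigroup $H$, its pseudo-Frobenius numbers are the elements of $\operatorname{PF}(H)=\{x\in\mathbb{Z}\setminus H\mid x+h\in H\ \forall\, 0\neq h\in H\}$. $\operatorname{F}(S)=\max\{s\in\mathbb{Z}\setminus S\mid s\equiv0\bmod d\}$ (possibly negative), $N_0=\max\{r_k^2,r_k^2+\operatorname{F}(S)r_k\}$ (one has $N_0<r_k^4$). $\operatorname{Ap}(S,dn)=\{s\in S\mid s-dn\notin S\}$. For $n>N_0$ with $\gcd(n,d)=1$: $P_n=\{i\in\operatorname{Ap}(S,dn)\mid f\equiv i\bmod n\text{ for some }f\in\operatorname{PF}(M_n)\}$,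 $P_n'=\{i\in P_n\mid i<dn-r_k\}$, $P_n''=\{i\in P_n\mid i\ge dn-r_k\}$. Each $f\in\operatorname{PF}(M_n)$ is congruent mod $n$ to a unique $i\in P_n$, and this gives a bijection $\operatorname{PF}(M_n)\to P_n$. The map $\psi_n:P_n\to P_{n+r_k}$, $\psi_n(i)=i$ if $i<dn-r_k$ and $\psi_n(i)=i+dr_k$ if $i\ge dn-r_k$, is a bijection, and $\varphi_n:\operatorname{PF}(M_n)\to\operatorname{PF}(M_{n+r_k})$ is the induced bijection: if $f\equiv i\bmod n$ with $i\in P_n$, then $\varphi_n(f)$ is the unique element of $\operatorname{PF}(M_{n+r_k})$ congruent to $\psi_n(i)$ mod $n+r_k$. Put $\varphi_n^\lambda=\varphi_{n+(\lambda-1)r_k}\circ\dots\circ\varphi_{n+r_k}\circ\varphi_n$ ($\varphi_n^0=\mathrm{id}$). *)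

theory Defs
  imports "HOL-Number_Theory.Number_Theory"
begin

text \<open>Everything lives in the integers. The parameter \<open>r\<close> lists the integers
  \<open>r 0 = 0 < r 1 < \<dots> < r k\<close>; only the values \<open>r 0, \<dots>, r k\<close> matter.\<close>

text \<open>Intended for finite \<open>A\<close> only.\<close>
definition nat_span :: "int set \<Rightarrow> int set" where
  "nat_span A = {\<Sum>a\<in>A. int (c a) * a | c :: int \<Rightarrow> nat. True}"

definition PF :: "int set \<Rightarrow> int set" where
  "PF H = {x. x \<notin> H \<and> (\<forall>h\<in>H. h \<noteq> 0 \<longrightarrow> x + h \<in> H)}"

definition Ap :: "int set \<Rightarrow> int \<Rightarrow> int set" where
  "Ap S m = {s \<in> S. s - m \<notin> S}"

definition gcd_gens :: "(nat \<Rightarrow> int) \<Rightarrow> nat \<Rightarrow> int" where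
  "gcd_gens r k = Gcd (r ` {1..k})"

definition S_gens :: "(nat \<Rightarrow> int) \<Rightarrow> nat \<Rightarrow> int set" where
  "S_gens r k = nat_span (r ` {1..k})"

text \<open>The generator \<open>n\<close> is the term for \<open>j = 0\<close>, as \<open>r 0 = 0\<close>.\<close>
definition M :: "(nat \<Rightarrow> int) \<Rightarrow> nat \<Rightarrow> int \<Rightarrow> int set" where
  "M r k n = nat_span ((\<lambda>j. n + r j) ` {0..k})"

definition P :: "(nat \<Rightarrow> int) \<Rightarrow> nat \<Rightarrow> int \<Rightarrow> int set" where
  "P r k n = {i \<in> Ap (S_gens r k) (gcd_gens r k * n). \<exists>f\<in>PF (M r k n). [f = i] (mod n)}"

definition P' :: "(nat \<Rightarrow> int) \<Rightarrow> nat \<Rightarrow> int \<Rightarrow> int set" where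
  "P' r k n = {i \<in> P r k n. i < gcd_gens r k * n - r k}"

definition P'' :: "(nat \<Rightarrow> int) \<Rightarrow> nat \<Rightarrow> int \<Rightarrow> int set" where
  "P'' r k n = {i \<in> P r k n. i \<ge> gcd_gens r k * n - r k}"

definition psi :: "(nat \<Rightarrow> int) \<Rightarrow> nat \<Rightarrow> int \<Rightarrow> int \<Rightarrow> int" where
  "psi r k n i = (if i < gcd_gens r k * n - r k then i else i + gcd_gens r k * r k)"

text \<open>Both descriptions below denote a unique element whenever \<open>n\<close> is coprime to
  \<open>gcd_gens r k\<close>, \<open>n \<ge> r k ^ 4\<close> and \<open>f \<in> PF (M r k n)\<close>; otherwise the value of \<open>phi\<close> is
  not meaningful.\<close>
definition phi :: "(nat \<Rightarrow> int) \<Rightarrow> nat \<Rightarrow> int \<Rightarrow> int \<Rightarrow> int" where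
  "phi r k n f =
     (let i = (THE i. i \<in> P r k n \<and> [f = i] (mod n))
      in THE g. g \<in> PF (M r k (n + r k)) \<and> [g = psi r k n i] (mod (n + r k)))"

text \<open>\<open>phi_iter r k n l\<close> is the composite of \<open>phi r k n\<close>, \<open>phi r k (n + r k)\<close>, \<open>\<dots>\<close>,
  \<open>phi r k (n + (l - 1) * r k)\<close>, with \<open>phi r k n\<close> applied first; the modulus changes at each
  step, so this is not a power of a single map.\<close>
primrec phi_iter :: "(nat \<Rightarrow> int) \<Rightarrow> nat \<Rightarrow> int \<Rightarrow> nat \<Rightarrow> int \<Rightarrow> int" where
  "phi_iter r k n 0 = id"
| "phi_iter r k n (Suc l) = phi r k (n + int l * r k) \<circ> phi_iter r k n l"

end

theory Submission
  imports Defs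
begin

text \<open>
  Let \<open>b = r k\<close> and let \<open>min_length s\<close> be the smallest number of generators that add up to
  \<open>s \<in> S\<close>. Since \<open>r 0 = 0\<close>, a sum of \<open>L\<close> generators of \<open>M\<^sub>n\<close> is \<open>L * n + s\<close> where \<open>s\<close> is a sum of
  at most \<open>L\<close> generators of \<open>S\<close>; so \<open>M\<^sub>n\<close> consists of the \<open>L * n + s\<close> with
  \<open>min_length s \<le> L\<close>, and every question about \<open>M\<^sub>n\<close> becomes one about \<open>min_length\<close>.

  A shortest factorization contains fewer than \<open>b\<close> generators other than \<open>b\<close>
  (\<open>shortest_few_small\<close>). This has two consequences: \<open>min_length s\<close> differs from \<open>s / b\<close> by less
  than \<open>b\<close>, and \<open>min_length (s + b) = min_length s + 1\<close> as soon as \<open>s + b > (b - 1)\<^sup>2\<close>.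

  The first one shows that an element of \<open>S\<close> in the class of \<open>i \<in> Ap S (d * n)\<close> modulo \<open>n\<close>,
  being larger than \<open>i\<close> by a multiple of \<open>d * n\<close>, never has a smaller length. Hence
  \<open>min_length i * n + i\<close> is the least element of \<open>M\<^sub>n\<close> in this class, and the only candidate for
  a pseudo-Frobenius number there is \<open>pf_value i = (min_length i - 1) * n + i\<close>. It is one iff
  for every generator \<open>a\<close> of \<open>S\<close> either \<open>i + a\<close> leaves the Apery set or
  \<open>min_length (i + a) \<le> min_length i\<close> (\<open>pf_value_mem_PF_iff\<close>).

  By the second consequence with \<open>a = b\<close>, the low residues \<open>i < d * n - b\<close> that satisfy this
  criterion are at most \<open>(b - 1)\<^sup>2 - b\<close>. The others, the high residues, lie in an interval of
  length less than \<open>n\<close> around \<open>d * n\<close>, where \<open>min_length\<close> is at least as large, so all values at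
  low residues precede all values at high ones; the number of the former is the index \<open>s\<close>. Within either kind
  \<open>pf_value\<close> orders the residues lexicographically by \<open>(min_length i, i)\<close>, because they differ
  by less than \<open>n\<close>. Passing from \<open>n\<close> to \<open>n + b\<close> fixes the low residues and adds
  \<open>d * b\<close> to the high ones, hence \<open>d\<close> to all lengths that occur there. This
  preserves the criterion, the kind and both lexicographic orders, so \<open>\<phi>\<^sub>n\<close> maps
  \<open>PF(M\<^sub>n)\<close> into \<open>PF(M\<^sub>n\<^sub>+\<^sub>b)\<close> and is strictly increasing. The estimates rest on
  \<open>n \<ge> 2 * b\<^sup>2\<close>, which follows from \<open>n \<ge> b ^ 4\<close> as \<open>b \<ge> 2\<close>, and persists along the iteration.
\<close>

section \<open>Sums of lists and subgroups of the integers\<close>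

lemma nat_span_eq_sum_lists:
  assumes "finite A"
  shows "nat_span A = {sum_list xs | xs. set xs \<subseteq> A}"
proof (intro equalityI subsetI)
  fix x assume "x \<in> nat_span A"
  then obtain c :: "int \<Rightarrow> nat" where x: "x = (\<Sum>a\<in>A. int (c a) * a)"
    unfolding nat_span_def by auto
  have "\<exists>xs. set xs \<subseteq> B \<and> sum_list xs = (\<Sum>a\<in>B. int (c a) * a)" if "finite B" for B
    using that
  proof (induction B)
    case empty
    show ?case by simp
  next
    case (insert a B)
    then obtain xs where "set xs \<subseteq> B" "sum_list xs = (\<Sum>a\<in>B. int (c a) * a)" by auto
    with insert.hyps show ?case
      by (intro exI[of _ "replicate (c a) a @ xs"]) (auto simp: sum_list_replicate)
  qed
  from this[OF assms] show "x \<in> {sum_list xs | xs. set xs \<subseteq> A}"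
    unfolding x by (auto intro: sym)
next
  fix x assume "x \<in> {sum_list xs | xs. set xs \<subseteq> A}"
  then obtain xs where xs: "set xs \<subseteq> A" "x = sum_list xs" by auto
  have "sum_list xs = (\<Sum>a\<in>A. int (count_list xs a) * a)"
    using xs(1)
  proof (induction xs)
    case Nil
    show ?case by simp
  next
    case (Cons y ys)
    have "(\<Sum>a\<in>A. int (count_list (y # ys) a) * a)
        = (\<Sum>a\<in>A. (if a = y then a else 0) + int (count_list ys a) * a)"
      by (intro sum.cong) (auto simp: algebra_simps)
    also have "\<dots> = y + (\<Sum>a\<in>A. int (count_list ys a) * a)"
      using Cons.prems assms by (simp add: sum.distrib)
    finally show ?case using Cons by simp
  qed
  then show "x \<in> nat_span A" unfolding nat_span_def xs(2) by (auto intro!: exI[of _ "count_list xs"])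
qed

text \<open>Among the \<open>length ys + 1 > b\<close> prefix sums two agree modulo \<open>b\<close>; the block between them
  has a sum divisible by \<open>b\<close>.\<close>

lemma obtain_block_with_dvd_sum:
  fixes ys :: "int list"
  assumes "0 < b" "b \<le> int (length ys)"
  obtains us vs ws where "ys = us @ vs @ ws" "vs \<noteq> []" "b dvd sum_list vs"
proof -
  define g where "g j = sum_list (take j ys) mod b" for j
  have "g ` {0..length ys} \<subseteq> {0..<b}" using assms by (auto simp: g_def)
  then have "card (g ` {0..length ys}) \<le> card {0..<b}" by (intro card_mono) auto
  also have "\<dots> < card {0..length ys}" using assms by auto
  finally have "\<not> inj_on g {0..length ys}" by (rule pigeonhole)
  then obtain p q where pq: "p < q" "q \<le> length ys" "g p = g q"
    unfolding inj_on_def by (metis atLeastAtMost_iff linorder_neqE_nat)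
  have q: "take q ys = take p ys @ drop p (take q ys)"
    using pq by (metis append_take_drop_id min.absorb1 less_imp_le take_take)
  have "b dvd sum_list (take q ys) - sum_list (take p ys)"
    using pq(3) unfolding g_def by (metis mod_eq_dvd_iff)
  then have "b dvd sum_list (drop p (take q ys))"
    by (subst (asm) q) simp
  moreover have "ys = take p ys @ drop p (take q ys) @ drop q ys"
    using q by (metis append.assoc append_take_drop_id)
  moreover have "drop p (take q ys) \<noteq> []" using pq by auto
  ultimately show ?thesis using that by blast
qed

lemma Gcd_mem_subgroup:
  fixes G :: "int set"
  assumes "finite A" "A \<subseteq> G" "0 \<in> G"
    and add: "\<And>x y. x \<in> G \<Longrightarrow> y \<in> G \<Longrightarrow> x + y \<in> G"
    and neg: "\<And>x. x \<in> G \<Longrightarrow> - x \<in> G"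
  shows "c * Gcd A \<in> G"
proof -
  have nat_mult: "int m * x \<in> G" if "x \<in> G" for m x
    using that by (induction m) (auto simp: assms(3) algebra_simps intro: add)
  have mult: "u * x \<in> G" if "x \<in> G" for u x
    using nat_mult[OF that, of "nat \<bar>u\<bar>"] neg[OF nat_mult[OF that, of "nat \<bar>u\<bar>"]]
    by (cases "u \<ge> 0") auto
  have "Gcd A \<in> G" using assms(1,2)
  proof (induction A)
    case empty
    show ?case using assms(3) by simp
  next
    case (insert a A)
    obtain u v where "u * a + v * Gcd A = gcd a (Gcd A)" using bezout_int by blast
    moreover have "u * a + v * Gcd A \<in> G"
      using insert by (intro add mult) auto
    ultimately show ?case by simp
  qed
  then show ?thesis by (rule mult)
qed

section \<open>Shortest factorizations\<close>

locale bounded_generators =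
  fixes R :: "int set" and b :: int
  assumes finite_R: "finite R" and b_mem: "b \<in> R"
    and bounds: "\<And>a. a \<in> R \<Longrightarrow> 0 < a \<and> a \<le> b"
begin

abbreviation S :: "int set" where "S \<equiv> nat_span R"

abbreviation d :: int where "d \<equiv> Gcd R"

definition min_length :: "int \<Rightarrow> nat" where
  "min_length s = (LEAST L. \<exists>xs. set xs \<subseteq> R \<and> sum_list xs = s \<and> length xs = L)"

lemma b_pos: "0 < b"
  using b_mem bounds by blast

lemma d_pos: "0 < d"
  using b_mem b_pos by (metis Gcd_0_iff Gcd_int_greater_eq_0 dual_order.strict_iff_order
      empty_iff insert_iff subset_iff)

lemma mem_S_iff: "s \<in> S \<longleftrightarrow> (\<exists>xs. set xs \<subseteq> R \<and> sum_list xs = s)"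
  using nat_span_eq_sum_lists[OF finite_R] by auto

lemma sum_list_mem_S: "set xs \<subseteq> R \<Longrightarrow> sum_list xs \<in> S"
  using mem_S_iff by blast

lemma zero_mem_S: "0 \<in> S"
  using sum_list_mem_S[of "[]"] by simp

lemma gen_mem_S: "a \<in> R \<Longrightarrow> a \<in> S"
  using sum_list_mem_S[of "[a]"] by simp

lemma S_add:
  assumes "x \<in> S" "y \<in> S"
  shows "x + y \<in> S"
proof -
  obtain xs ys where "set xs \<subseteq> R" "sum_list xs = x" "set ys \<subseteq> R" "sum_list ys = y"
    using assms by (auto simp: mem_S_iff)
  then show ?thesis using sum_list_mem_S[of "xs @ ys"] by simp
qed

lemma S_mult: "x \<in> S \<Longrightarrow> int c * x \<in> S"
  by (induction c) (auto simp: zero_mem_S algebra_simps intro: S_add)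

lemma S_dvd: "s \<in> S \<Longrightarrow> d dvd s"
  by (auto simp: nat_span_def intro!: dvd_sum)

lemma sum_list_bounds:
  assumes "set xs \<subseteq> R"
  shows "int (length xs) \<le> sum_list xs" "sum_list xs \<le> b * int (length xs)"
proof -
  have "int (length xs) \<le> sum_list xs \<and> sum_list xs \<le> b * int (length xs)"
    using assms
  proof (induction xs)
    case (Cons x xs)
    then show ?case using bounds[of x] by (auto simp: algebra_simps)
  qed simp
  then show "int (length xs) \<le> sum_list xs" "sum_list xs \<le> b * int (length xs)" by auto
qed

lemma min_length_le:
  assumes "set xs \<subseteq> R" "sum_list xs = s"
  shows "min_length s \<le> length xs"
  unfolding min_length_def using assms by (intro Least_le) auto

lemma obtain_shortest:
  assumes "s \<in> S"
  obtains xs where "set xs \<subseteq> R" "sum_list xs = s" "length xs = min_length s"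
proof -
  have "\<exists>L xs. set xs \<subseteq> R \<and> sum_list xs = s \<and> length xs = L"
    using assms by (auto simp: mem_S_iff)
  from LeastI_ex[OF this] show ?thesis unfolding min_length_def[symmetric] using that by blast
qed

lemma S_nonneg: "s \<in> S \<Longrightarrow> 0 \<le> s"
  by (metis mem_S_iff of_nat_0_le_iff order_trans sum_list_bounds(1))

lemma le_b_min_length: "s \<in> S \<Longrightarrow> s \<le> b * int (min_length s)"
  by (metis obtain_shortest sum_list_bounds(2))

lemma min_length_add_gen:
  assumes "s \<in> S" "a \<in> R"
  shows "min_length (s + a) \<le> min_length s + 1"
proof -
  obtain xs where "set xs \<subseteq> R" "sum_list xs = s" "length xs = min_length s"
    using obtain_shortest[OF assms(1)] .
  then show ?thesis using min_length_le[of "a # xs" "s + a"] assms(2) by simp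
qed

text \<open>A shortest factorization cannot contain a nonempty block of generators smaller than \<open>b\<close>
  whose sum is \<open>c * b\<close>: the block would be longer than the \<open>c\<close> copies of \<open>b\<close> that can replace
  it. By the pigeonhole principle such a block exists as soon as there are \<open>b\<close> generators
  smaller than \<open>b\<close>.\<close>

lemma shortest_few_small:
  assumes "set xs \<subseteq> R" "length xs = min_length (sum_list xs)"
  shows "int (length (filter (\<lambda>x. x \<noteq> b) xs)) < b"
proof (rule ccontr)
  let ?ys = "filter (\<lambda>x. x \<noteq> b) xs" and ?zs = "filter (\<lambda>x. \<not> x \<noteq> b) xs"
  assume "\<not> ?thesis"
  then obtain us vs ws where ys: "?ys = us @ vs @ ws" "vs \<noteq> []" "b dvd sum_list vs"
    using obtain_block_with_dvd_sum[OF b_pos, of ?ys] by auto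
  have "set (us @ vs @ ws) \<subseteq> R - {b}" unfolding ys(1)[symmetric] using assms(1) by auto
  then have sub: "set us \<subseteq> R" "set ws \<subseteq> R" "set vs \<subseteq> R - {b}" by auto
  have "sum_list vs < b * int (length vs)" using ys(2) sub(3)
  proof (induction vs rule: list_nonempty_induct)
    case (single x)
    then show ?case using bounds[of x] by auto
  next
    case (cons x xs)
    then show ?case using bounds[of x] by (auto simp: algebra_simps)
  qed
  moreover obtain c where c: "sum_list vs = b * c" using ys(3) by auto
  ultimately have "c < int (length vs)" using b_pos by (metis mult_less_cancel_left_pos)
  have "0 \<le> sum_list vs"
    using sum_list_bounds(1)[of vs] sub(3) by (meson Diff_subset of_nat_0_le_iff order_trans)
  then have "0 \<le> c" using c b_pos by (simp add: zero_le_mult_iff)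
  let ?new = "us @ replicate (nat c) b @ ws @ ?zs"
  have part: "sum_list xs = sum_list ?ys + sum_list ?zs" "length xs = length ?ys + length ?zs"
    by (induction xs) auto
  have "sum_list ?new = sum_list xs"
    using \<open>0 \<le> c\<close> part(1) by (simp add: ys(1) c sum_list_replicate)
  moreover have "set ?new \<subseteq> R" using sub assms(1) b_mem by auto
  ultimately have "min_length (sum_list xs) \<le> length ?new" by (intro min_length_le)
  also have "\<dots> < length xs"
    using \<open>c < int (length vs)\<close> \<open>0 \<le> c\<close> part(2) by (simp add: ys(1))
  finally show False using assms(2) by simp
qed

lemma b_min_length_le:
  assumes "s \<in> S"
  shows "b * int (min_length s) \<le> s + b * (b - 1)"
proof -
  obtain xs where xs: "set xs \<subseteq> R" "sum_list xs = s" "length xs = min_length s"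
    using obtain_shortest[OF assms] .
  let ?ys = "filter (\<lambda>x. x \<noteq> b) xs"
  have "b * int (length xs) \<le> sum_list xs + b * int (length ?ys)"
    using xs(1)
  proof (induction xs)
    case (Cons x xs)
    then show ?case using bounds[of x] by (auto simp: algebra_simps)
  qed simp
  also have "b * int (length ?ys) \<le> b * (b - 1)"
    using shortest_few_small[OF xs(1)] xs b_pos by (intro mult_left_mono) auto
  finally show ?thesis using xs by simp
qed

text \<open>The rough size \<open>s / b \<le> min_length s \<le> s / b + b - 1\<close> makes \<open>min_length\<close>, in general not
  monotone, increase weakly along steps that are not too short.\<close>

lemma min_length_mono:
  assumes "x \<in> S" "y \<in> S" "x + b * (b - 1) \<le> y"
  shows "min_length x \<le> min_length y"
proof -
  have "b * int (min_length x) \<le> b * int (min_length y)"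
    using b_min_length_le[OF assms(1)] le_b_min_length[OF assms(2)] assms(3) by linarith
  then show ?thesis using b_pos by simp
qed

text \<open>Fewer than \<open>b\<close> generators smaller than \<open>b\<close> add up to at most \<open>(b - 1)\<^sup>2\<close>, so beyond this
  bound a shortest factorization uses \<open>b\<close>.\<close>

lemma large_minus_b:
  assumes "s \<in> S" "(b - 1)^2 < s"
  shows "s - b \<in> S" "min_length s = min_length (s - b) + 1"
proof -
  obtain xs where xs: "set xs \<subseteq> R" "sum_list xs = s" "length xs = min_length s"
    using obtain_shortest[OF assms(1)] .
  have "b \<in> set xs"
  proof (rule ccontr)
    assume "b \<notin> set xs"
    then have *: "filter (\<lambda>x. x \<noteq> b) xs = xs" by (auto simp: filter_id_conv)
    have "sum_list xs \<le> (b - 1) * int (length xs)" using xs(1) \<open>b \<notin> set xs\<close>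
    proof (induction xs)
      case (Cons x xs)
      then show ?case using bounds[of x] by (auto simp: algebra_simps)
    qed simp
    also have "\<dots> \<le> (b - 1) * (b - 1)"
      using shortest_few_small[OF xs(1)] xs * b_pos by (intro mult_left_mono) auto
    finally show False using assms(2) xs(2) by (simp add: power2_eq_square)
  qed
  then obtain us vs where "xs = us @ b # vs" by (auto simp: in_set_conv_decomp)
  then have new: "set (us @ vs) \<subseteq> R" "sum_list (us @ vs) = s - b"
    "length (us @ vs) + 1 = min_length s"
    using xs by auto
  then show "s - b \<in> S" using sum_list_mem_S by metis
  then show "min_length s = min_length (s - b) + 1"
    using min_length_le[OF new(1,2)] new(3) min_length_add_gen[of "s - b" b] b_mem by simp
qed

lemma min_length_add_b_mult:
  assumes "s \<in> S" "(b - 1)^2 < s + b"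
  shows "min_length (s + int c * b) = min_length s + c"
proof (induction c)
  case (Suc c)
  have "s + int (Suc c) * b \<in> S" using S_mult[OF gen_mem_S[OF b_mem]] assms(1) S_add by blast
  moreover have "(b - 1)^2 < s + int (Suc c) * b"
    unfolding of_nat_Suc distrib_right
      using assms(2) mult_nonneg_nonneg[OF of_nat_0_le_iff less_imp_le[OF b_pos], of c] by linarith
  ultimately have "min_length (s + int (Suc c) * b) = min_length (s + int (Suc c) * b - b) + 1"
    by (rule large_minus_b(2))
  then show ?case using Suc by (simp add: algebra_simps)
qed simp

text \<open>The integers that lie in \<open>S\<close> after adding a multiple of \<open>b\<close> form a subgroup: the negative
  of \<open>x\<close> becomes \<open>(b - 1) * x\<close>. So this subgroup contains all multiples of \<open>d\<close>,
  and above \<open>(b - 1)\<^sup>2\<close> the multiples of \<open>b\<close> can be removed again.\<close>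

lemma large_multiple_mem_S:
  assumes "d dvd x" "(b - 1)^2 < x + b"
  shows "x \<in> S"
proof -
  define G where "G = {x. \<exists>c::nat. x + int c * b \<in> S}"
  have G_S: "x \<in> G" if "x \<in> S" for x
    using that unfolding G_def by (auto intro: exI[of _ 0])
  have G_add: "x + y \<in> G" if xy: "x \<in> G" "y \<in> G" for x y
  proof -
    obtain u v :: nat where "x + int u * b \<in> S" "y + int v * b \<in> S" using xy by (auto simp: G_def)
    then have "(x + int u * b) + (y + int v * b) \<in> S" by (rule S_add)
    also have "(x + int u * b) + (y + int v * b) = x + y + int (u + v) * b"
      by (simp add: algebra_simps)
    finally show ?thesis unfolding G_def by blast
  qed
  have "- x \<in> G" if x: "x \<in> G" for x
  proof -
    obtain u :: nat where u: "x + int u * b \<in> S" using x by (auto simp: G_def)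
    let ?y = "x + int u * b"
    have "int (nat (b - 1)) * ?y \<in> S" using S_mult[OF u] .
    also have "int (nat (b - 1)) * ?y = - ?y + int (nat ?y) * b"
      using b_pos S_nonneg[OF u] by (simp add: algebra_simps)
    finally have "- ?y \<in> G" unfolding G_def by blast
    moreover have "int u * b \<in> G" using G_S S_mult[OF gen_mem_S[OF b_mem]] by blast
    ultimately have "- ?y + int u * b \<in> G" by (rule G_add)
    then show ?thesis by simp
  qed
  moreover obtain c where "x = c * d" using assms(1) by (metis dvd_def mult.commute)
  ultimately have "x \<in> G"
    using Gcd_mem_subgroup[of R G] G_S G_add finite_R gen_mem_S zero_mem_S by blast
  then obtain c :: nat where "x + int c * b \<in> S" unfolding G_def by blast
  then show ?thesis
  proof (induction c)
    case (Suc c)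
    have "(b - 1)^2 < x + int (Suc c) * b"
      unfolding of_nat_Suc distrib_right
      using assms(2) mult_nonneg_nonneg[OF of_nat_0_le_iff less_imp_le[OF b_pos], of c] by linarith
    from large_minus_b(1)[OF Suc.prems this] Suc.IH show ?case by (simp add: algebra_simps)
  qed simp
qed

end

section \<open>Apery sets and pseudo-Frobenius numbers of shifted semigroups\<close>

locale shifted_generators = bounded_generators +
  fixes n :: int
  assumes n_large: "2 * b^2 \<le> n" and n_coprime: "coprime n d"
begin

definition shift :: "int set" where
  "shift = nat_span ((\<lambda>a. n + a) ` insert 0 R)"

text \<open>The only possible pseudo-Frobenius number of \<open>shift\<close> in the class of \<open>i\<close> modulo \<open>n\<close>, see
  \<open>PF_eq_pf_value\<close> below.\<close>

definition pf_value :: "int \<Rightarrow> int" where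
  "pf_value i = (int (min_length i) - 1) * n + i"

lemma n_pos: "0 < n"
  using n_large b_pos by (smt (verit) zero_less_power)

lemma n_le_dn: "n \<le> d * n"
  using d_pos n_pos by simp

lemma b_bounds: "b \<le> b^2" "(b - 1)^2 \<le> b^2 - b" "b * (b - 1) = b^2 - b"
  using b_pos by (auto simp: power2_eq_square algebra_simps)

lemma dn_mem_S: "d * n \<in> S"
proof (rule large_multiple_mem_S)
  show "(b - 1)^2 < d * n + b" using n_large n_le_dn b_bounds b_pos by linarith
qed simp

lemma shift_eq_sum_lists:
  "shift = {sum_list xs | xs. set xs \<subseteq> (\<lambda>a. n + a) ` insert 0 R}"
  unfolding shift_def using finite_R by (intro nat_span_eq_sum_lists) simp

text \<open>A summand \<open>n + 0\<close> contributes to \<open>L\<close> but not to \<open>s\<close>, so a shortest factorization of \<open>s\<close>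
  can be padded to any larger number of summands.\<close>

lemma mem_shift_iff: "x \<in> shift \<longleftrightarrow> (\<exists>L s. x = int L * n + s \<and> s \<in> S \<and> min_length s \<le> L)"
proof
  assume "x \<in> shift"
  then obtain xs where xs: "set xs \<subseteq> (\<lambda>a. n + a) ` insert 0 R" "x = sum_list xs"
    unfolding shift_eq_sum_lists by blast
  define ys where "ys = map (\<lambda>x. x - n) xs"
  define zs where "zs = filter (\<lambda>y. y \<noteq> 0) ys"
  have "set ys \<subseteq> insert 0 R" using xs(1) by (auto simp: ys_def)
  then have zs: "set zs \<subseteq> R" by (auto simp: zs_def)
  have "sum_list zs = sum_list ys" unfolding zs_def by (induction ys) auto
  moreover have "x = int (length xs) * n + sum_list ys"
    unfolding xs(2) ys_def by (induction xs) (auto simp: algebra_simps)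
  moreover have "length zs \<le> length xs"
    unfolding zs_def ys_def by (metis length_filter_le length_map)
  then have "min_length (sum_list zs) \<le> length xs"
    using min_length_le[OF zs refl] by linarith
  ultimately show "\<exists>L s. x = int L * n + s \<and> s \<in> S \<and> min_length s \<le> L"
    using sum_list_mem_S[OF zs] by metis
next
  assume "\<exists>L s. x = int L * n + s \<and> s \<in> S \<and> min_length s \<le> L"
  then obtain L s where L: "x = int L * n + s" "s \<in> S" "min_length s \<le> L" by blast
  obtain xs where xs: "set xs \<subseteq> R" "sum_list xs = s" "length xs = min_length s"
    using obtain_shortest[OF L(2)] .
  define ys where "ys = map (\<lambda>a. n + a) (xs @ replicate (L - length xs) 0)"
  have "sum_list ys = int (length xs + (L - length xs)) * n + s"
    unfolding ys_def by (simp add: sum_list_addf sum_list_triv sum_list_replicate xs(2) algebra_simps)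
  then have "sum_list ys = x" using L xs(3) by simp
  moreover have "set ys \<subseteq> (\<lambda>a. n + a) ` insert 0 R" using xs(1) by (auto simp: ys_def)
  ultimately show "x \<in> shift"
    unfolding shift_eq_sum_lists by blast
qed

lemma shift_gen: "a \<in> insert 0 R \<Longrightarrow> n + a \<in> shift"
  unfolding shift_eq_sum_lists by (auto intro!: exI[of _ "[n + a]"])

lemma shift_add:
  assumes "x \<in> shift" "y \<in> shift"
  shows "x + y \<in> shift"
proof -
  obtain xs ys where "set xs \<subseteq> (\<lambda>a. n + a) ` insert 0 R" "x = sum_list xs"
    "set ys \<subseteq> (\<lambda>a. n + a) ` insert 0 R" "y = sum_list ys"
    using assms unfolding shift_eq_sum_lists by auto
  then show ?thesis unfolding shift_eq_sum_lists by (auto intro!: exI[of _ "xs @ ys"])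
qed

lemma shift_nonzero_cases:
  assumes "h \<in> shift" "h \<noteq> 0"
  obtains a h' where "a \<in> insert 0 R" "h' \<in> shift" "h = n + a + h'"
proof -
  obtain xs where xs: "set xs \<subseteq> (\<lambda>a. n + a) ` insert 0 R" "h = sum_list xs"
    using assms(1) unfolding shift_eq_sum_lists by auto
  then obtain y ys where y: "xs = y # ys" using assms(2) by (cases xs) auto
  then obtain a where "a \<in> insert 0 R" "y = n + a" using xs(1) by auto
  moreover have "sum_list ys \<in> shift" using xs(1) y unfolding shift_eq_sum_lists by auto
  ultimately show ?thesis using that xs(2) y by auto
qed

text \<open>Since \<open>S\<close> consists of multiples of \<open>d\<close>, congruence modulo \<open>n\<close> within \<open>S\<close> is congruence
  modulo \<open>d * n\<close>, so an element of \<open>Ap S (d * n)\<close> is the smallest element of \<open>S\<close> in its class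
  modulo \<open>n\<close>.\<close>

lemma Ap_least_in_class:
  assumes "i \<in> Ap S (d * n)" "s \<in> S" "[s = i] (mod n)"
  obtains c :: nat where "s = i + int c * (d * n)"
proof -
  have "n dvd s - i" using assms(3) by (simp add: cong_iff_dvd_diff)
  moreover have "d dvd s - i" using assms S_dvd by (auto simp: Ap_def)
  ultimately have "d * n dvd s - i" using n_coprime by (simp add: coprime_commute divides_mult)
  then obtain c where c: "s = i + c * (d * n)" by (metis add.commute diff_add_cancel dvdE mult.commute)
  have "0 \<le> c"
  proof (rule ccontr)
    assume "\<not> 0 \<le> c"
    then have "i - d * n = s + int (nat (- c - 1)) * (d * n)" using c by (simp add: algebra_simps)
    then have "i - d * n \<in> S" using S_add[OF assms(2) S_mult[OF dn_mem_S]] by metis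
    then show False using assms(1) by (simp add: Ap_def)
  qed
  then show ?thesis using that[of "nat c"] c by simp
qed

lemma Ap_unique:
  assumes "i \<in> Ap S (d * n)" "j \<in> Ap S (d * n)" "[i = j] (mod n)"
  shows "i = j"
proof -
  obtain c :: nat where c: "i = j + int c * (d * n)"
    using Ap_least_in_class[of j i] assms by (auto simp: Ap_def)
  obtain e :: nat where e: "j = i + int e * (d * n)"
    using Ap_least_in_class[of i j] assms by (auto simp: Ap_def cong_sym)
  have "0 \<le> int c * (d * n)" "0 \<le> int e * (d * n)" using n_le_dn n_pos by auto
  then show ?thesis using c e by linarith
qed

lemma obtain_Ap:
  assumes "s \<in> S"
  obtains i where "i \<in> Ap S (d * n)" "[s = i] (mod n)"
proof -
  have "\<exists>i. i \<in> Ap S (d * n) \<and> [s = i] (mod n)"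
    using assms
  proof (induction "nat s" arbitrary: s rule: less_induct)
    case less
    show ?case
    proof (cases "s - d * n \<in> S")
      case True
      have "nat (s - d * n) < nat s" using S_nonneg[OF True] n_le_dn n_pos by linarith
      from less.hyps[OF this True] obtain i where
        i: "i \<in> Ap S (d * n)" "[s - d * n = i] (mod n)" by blast
      then have "[s = i] (mod n)"
        by (metis cong_diff cong_mult_self_right cong_sym cong_trans diff_zero cong_refl)
      then show ?thesis using i by blast
    next
      case False
      then show ?thesis using less.prems by (auto simp: Ap_def)
    qed
  qed
  then show ?thesis using that by blast
qed

text \<open>The smallest element of the shifted semigroup in the class of \<open>i\<close> modulo \<open>n\<close> is
  \<open>min_length i * n + i\<close>: another element of \<open>S\<close> in this class exceeds \<open>i\<close> by at least
  \<open>d * n\<close>, which is so much that its shortest factorizations cannot be shorter.\<close>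

lemma mem_shift_Ap_iff:
  assumes "i \<in> Ap S (d * n)"
  shows "L * n + i \<in> shift \<longleftrightarrow> int (min_length i) \<le> L"
proof
  have iS: "i \<in> S" using assms by (simp add: Ap_def)
  assume "L * n + i \<in> shift"
  then obtain L' s where s: "L * n + i = int L' * n + s" "s \<in> S" "min_length s \<le> L'"
    unfolding mem_shift_iff by blast
  have "s - i = n * (L - int L')" using s(1) by (simp add: algebra_simps)
  then have "[s = i] (mod n)" by (simp add: cong_iff_dvd_diff)
  with assms s(2) obtain c :: nat where c: "s = i + int c * (d * n)" by (rule Ap_least_in_class)
  have "L * n = (int L' + int c * d) * n" using s(1) c by (simp add: algebra_simps)
  then have L: "L = int L' + int c * d" using n_pos by simp
  have "min_length i \<le> min_length s"
  proof (cases "c = 0")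
    case False
    then have "1 * (d * n) \<le> int c * (d * n)"
      using n_le_dn n_pos by (intro mult_right_mono) auto
    then have "i + b * (b - 1) \<le> s" using c n_le_dn n_large b_bounds b_pos by linarith
    then show ?thesis by (rule min_length_mono[OF iS s(2)])
  qed (simp add: c)
  moreover have "0 \<le> int c * d" using d_pos by simp
  ultimately show "int (min_length i) \<le> L" using L s(3) by linarith
next
  assume "int (min_length i) \<le> L"
  then show "L * n + i \<in> shift"
    unfolding mem_shift_iff using assms by (auto simp: Ap_def intro!: exI[of _ "nat L"] exI[of _ i])
qed

text \<open>A pseudo-Frobenius number \<open>f\<close> is not in the semigroup but \<open>f + n\<close> is, so \<open>f + n\<close> is the
  smallest element of its class modulo \<open>n\<close>.\<close>

lemma PF_eq_pf_value:
  assumes "f \<in> PF shift" "i \<in> Ap S (d * n)" "[f = i] (mod n)"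
  shows "f = pf_value i"
proof -
  obtain L where L: "f = L * n + i"
    using assms(3) by (metis cong_iff_dvd_diff diff_add_cancel dvdE mult.commute)
  have "f + n \<in> shift" using assms(1) shift_gen[of 0] n_pos by (auto simp: PF_def)
  then have "(L + 1) * n + i \<in> shift" by (simp add: L algebra_simps)
  then have "int (min_length i) \<le> L + 1" by (simp only: mem_shift_Ap_iff[OF assms(2)])
  moreover have "\<not> int (min_length i) \<le> L"
    using assms(1) unfolding L PF_def mem_Collect_eq mem_shift_Ap_iff[OF assms(2)] by blast
  ultimately have "L = int (min_length i) - 1" by simp
  then show ?thesis unfolding L pf_value_def by simp
qed

lemma obtain_Ap_of_PF:
  assumes "f \<in> PF shift"
  obtains i where "i \<in> Ap S (d * n)" "f = pf_value i"
proof -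
  have "f + n \<in> shift" using assms shift_gen[of 0] n_pos by (auto simp: PF_def)
  then obtain L s where s: "f + n = int L * n + s" "s \<in> S" unfolding mem_shift_iff by blast
  obtain i where i: "i \<in> Ap S (d * n)" "[s = i] (mod n)" using obtain_Ap[OF s(2)] .
  have "f - s = n * (int L - 1)" using s(1) by (simp add: algebra_simps)
  then have "[f = s] (mod n)" by (simp add: cong_iff_dvd_diff)
  then have "[f = i] (mod n)" using i(2) by (rule cong_trans)
  with PF_eq_pf_value[OF assms i(1)] i(1) that show ?thesis by blast
qed

lemma pf_value_cong: "[pf_value i = i] (mod n)"
  by (simp add: pf_value_def cong_iff_dvd_diff)

text \<open>For \<open>a \<in> R\<close>, the generator \<open>n + a\<close> added to \<open>pf_value i\<close> gives \<open>min_length i * n + (i + a)\<close>. If \<open>i + a\<close>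
  is in the Apery set, this is an element iff \<open>min_length (i + a) \<le> min_length i\<close>. Otherwise
  \<open>i + a = j + d * n\<close> with \<open>j \<in> S\<close> far below \<open>i\<close>, and it always is one.\<close>

lemma pf_value_mem_PF_iff:
  assumes "i \<in> Ap S (d * n)"
  shows "pf_value i \<in> PF shift \<longleftrightarrow>
    (\<forall>a\<in>R. i + a - d * n \<in> S \<or> min_length (i + a) \<le> min_length i)"
    (is "_ \<longleftrightarrow> (\<forall>a\<in>R. ?C a)")
proof -
  have iS: "i \<in> S" using assms by (simp add: Ap_def)
  have add_gen: "pf_value i + (n + a) = int (min_length i) * n + (i + a)" for a
    by (simp add: pf_value_def algebra_simps)
  have gen_iff: "pf_value i + (n + a) \<in> shift \<longleftrightarrow> ?C a" if a: "a \<in> R" for a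
  proof (cases "i + a - d * n \<in> S")
    case True
    define j where "j = i + a - d * n"
    have jS: "j \<in> S" using True by (simp add: j_def)
    have "j + b * (b - 1) \<le> i"
      using bounds[OF a] n_le_dn n_large b_bounds b_pos unfolding j_def by linarith
    then have "min_length j \<le> min_length i" by (rule min_length_mono[OF jS iS])
    moreover have "int (min_length i) * n + (i + a) = int (min_length i + nat d) * n + j"
      using d_pos by (simp add: j_def algebra_simps)
    ultimately have "int (min_length i) * n + (i + a) \<in> shift"
      unfolding mem_shift_iff using jS by (metis trans_le_add1)
    then show ?thesis using True unfolding add_gen by blast
  next
    case False
    then have "i + a \<in> Ap S (d * n)" using S_add[OF iS gen_mem_S[OF a]] by (simp add: Ap_def)
    then show ?thesis unfolding add_gen using False by (simp add: mem_shift_Ap_iff)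
  qed
  show ?thesis
  proof
    assume PF: "pf_value i \<in> PF shift"
    show "\<forall>a\<in>R. ?C a"
    proof
      fix a assume a: "a \<in> R"
      have "n + a \<in> shift" "n + a \<noteq> 0" using shift_gen a bounds[OF a] n_pos by auto
      then have "pf_value i + (n + a) \<in> shift" using PF unfolding PF_def by blast
      then show "?C a" using gen_iff[OF a] by blast
    qed
  next
    assume C: "\<forall>a\<in>R. ?C a"
    have "pf_value i \<notin> shift" unfolding pf_value_def mem_shift_Ap_iff[OF assms] by simp
    moreover have "pf_value i + h \<in> shift" if h: "h \<in> shift" "h \<noteq> 0" for h
    proof -
      obtain a h' where a: "a \<in> insert 0 R" "h' \<in> shift" "h = n + a + h'"
        using shift_nonzero_cases[OF h] .
      have "pf_value i + (n + a) \<in> shift"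
      proof (cases "a = 0")
        case True
        then show ?thesis unfolding add_gen by (simp add: mem_shift_Ap_iff[OF assms])
      next
        case False
        then show ?thesis using a(1) C gen_iff by blast
      qed
      from shift_add[OF this a(2)] show ?thesis unfolding a(3) by (simp add: add.assoc)
    qed
    ultimately show "pf_value i \<in> PF shift" unfolding PF_def by blast
  qed
qed

definition PF_residues :: "int set" where
  "PF_residues = {i \<in> Ap S (d * n). pf_value i \<in> PF shift}"

lemma PF_residues_eq: "PF_residues = {i \<in> Ap S (d * n). \<exists>f\<in>PF shift. [f = i] (mod n)}"
  unfolding PF_residues_def using PF_eq_pf_value pf_value_cong by blast

text \<open>For \<open>i < d * n - b\<close> also \<open>i + b\<close> lies in the Apery set, which forces \<open>min_length (i + b) \<le> min_length i\<close>,
  whereas \<open>min_length (i + b) = min_length i + 1\<close> once \<open>i + b > (b - 1)\<^sup>2\<close>.\<close>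

lemma low_residue_small:
  assumes "i \<in> PF_residues" "i < d * n - b"
  shows "i + b \<le> (b - 1)^2"
proof (rule ccontr)
  assume "\<not> ?thesis"
  moreover have i: "i \<in> S" "i \<in> Ap S (d * n)" "pf_value i \<in> PF shift"
    using assms(1) by (auto simp: PF_residues_def Ap_def)
  ultimately have "min_length (i + int 1 * b) = min_length i + 1"
    by (intro min_length_add_b_mult) auto
  moreover have "i + b - d * n \<notin> S" using assms(2) S_nonneg by force
  ultimately show False using i(3) b_mem by (auto simp: pf_value_mem_PF_iff[OF i(2)])
qed

lemma Ap_upper:
  assumes "i \<in> Ap S (d * n)"
  shows "i - d * n + b \<le> (b - 1)^2"
proof (rule ccontr)
  assume "\<not> ?thesis"
  moreover have "d dvd i - d * n" using assms S_dvd by (auto simp: Ap_def)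
  ultimately have "i - d * n \<in> S" by (intro large_multiple_mem_S) auto
  then show False using assms by (simp add: Ap_def)
qed

text \<open>A low residue is at most \<open>(b - 1)\<^sup>2 - b\<close>, so \<open>min_length_mono\<close> applies across the gap
  between the low and the high residues.\<close>

lemma pf_value_low_less_high:
  assumes "i \<in> PF_residues" "i < d * n - b" "j \<in> PF_residues" "d * n - b \<le> j"
  shows "pf_value i < pf_value j"
proof -
  have "i + b \<le> (b - 1)^2" using low_residue_small assms by blast
  then have "i + b * (b - 1) \<le> j"
    using assms(4) n_le_dn n_large b_bounds b_pos by linarith
  then have "min_length i \<le> min_length j"
    using assms by (intro min_length_mono) (auto simp: PF_residues_def Ap_def)
  then have "(int (min_length i) - 1) * n \<le> (int (min_length j) - 1) * n"
    using n_pos by (intro mult_right_mono) auto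
  then show ?thesis unfolding pf_value_def using assms by linarith
qed

lemma pf_value_less_iff:
  assumes "\<bar>i - j\<bar> < n"
  shows "pf_value i < pf_value j \<longleftrightarrow>
    min_length i < min_length j \<or> min_length i = min_length j \<and> i < j"
proof -
  have less: "pf_value x < pf_value y" if "min_length x < min_length y" "\<bar>x - y\<bar> < n" for x y
  proof -
    have "int (min_length x) * n \<le> (int (min_length y) - 1) * n"
      using that(1) n_pos by (intro mult_right_mono) auto
    then show ?thesis using that(2) unfolding pf_value_def by (simp add: algebra_simps)
  qed
  consider "min_length i < min_length j" | "min_length j < min_length i"
    | "min_length i = min_length j" by linarith
  then show ?thesis
  proof cases
    case 2
    then show ?thesis using less[of j i] assms by (simp add: abs_minus_commute)
  qed (use less[of i j] assms in \<open>auto simp: pf_value_def\<close>)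
qed

lemma pf_value_less_iff_residues:
  assumes "i \<in> PF_residues" "j \<in> PF_residues" "i < d * n - b \<longleftrightarrow> j < d * n - b"
  shows "pf_value i < pf_value j \<longleftrightarrow>
    min_length i < min_length j \<or> min_length i = min_length j \<and> i < j"
proof (rule pf_value_less_iff)
  have ij: "0 \<le> i" "0 \<le> j" "i - d * n + b \<le> (b - 1)^2" "j - d * n + b \<le> (b - 1)^2"
    using assms(1,2) S_nonneg Ap_upper by (auto simp: PF_residues_def Ap_def)
  show "\<bar>i - j\<bar> < n"
  proof (cases "i < d * n - b")
    case True
    then have "i + b \<le> (b - 1)^2" "j + b \<le> (b - 1)^2"
      using low_residue_small assms by blast+
    then show ?thesis using ij n_large b_bounds b_pos by linarith
  next
    case False
    then show ?thesis using ij assms(3) n_large b_bounds b_pos by linarith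
  qed
qed

end

section \<open>Passing from one shift to the next\<close>

locale consecutive_shifts = shifted_generators +
  next_shift: shifted_generators R b "n + b"
begin

definition lift :: "int \<Rightarrow> int" where
  "lift i = (if i < d * n - b then i else i + d * b)"

lemma lift_low_iff: "lift i < d * (n + b) - b \<longleftrightarrow> i < d * n - b"
proof -
  have "0 < d * b" using d_pos b_pos by simp
  moreover have "d * (n + b) = d * n + d * b" by (rule distrib_left)
  ultimately show ?thesis unfolding lift_def by (cases "i < d * n - b") auto
qed

lemma min_length_lift:
  assumes "s \<in> S" "d * n - b \<le> s"
  shows "min_length (s + d * b) = min_length s + nat d"
proof -
  have "(b - 1)^2 < s + b" using assms(2) n_le_dn n_large b_bounds b_pos by linarith
  from min_length_add_b_mult[OF assms(1) this, of "nat d"] show ?thesis using d_pos by simp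
qed

text \<open>For low \<open>i\<close> no \<open>i + a\<close> reaches \<open>d * n\<close>, so the criterion \<open>pf_value_mem_PF_iff\<close> speaks
  only about lengths and does not depend on \<open>n\<close>. For high \<open>i\<close>, the differences \<open>i + a - d * n\<close>
  stay the same, and \<open>min_length\<close> grows by \<open>d\<close> both at \<open>i\<close> and at \<open>i + a\<close>.\<close>

lemma lift_mem_residues:
  assumes "i \<in> PF_residues"
  shows "lift i \<in> next_shift.PF_residues"
proof -
  have i: "i \<in> S" "i \<in> Ap S (d * n)"
    and C: "\<And>a. a \<in> R \<Longrightarrow> i + a - d * n \<in> S \<or> min_length (i + a) \<le> min_length i"
    using assms pf_value_mem_PF_iff[of i] by (auto simp: PF_residues_def Ap_def)
  show ?thesis
  proof (cases "i < d * n - b")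
    case True
    have "0 < d * b" using d_pos b_pos by simp
    have small: "i + a - d * (n + b) \<notin> S" if "a \<le> b" for a
      using S_nonneg[of "i + a - d * (n + b)"] True \<open>0 < d * b\<close> that by (auto simp: algebra_simps)
    have Ap: "i \<in> Ap S (d * (n + b))" using i(1) small[of 0] b_pos by (auto simp: Ap_def)
    have "min_length (i + a) \<le> min_length i" if a: "a \<in> R" for a
      using C[OF a] S_nonneg[of "i + a - d * n"] True bounds[OF a] by linarith
    then show ?thesis
      using Ap True next_shift.pf_value_mem_PF_iff[OF Ap]
      by (simp add: next_shift.PF_residues_def lift_def)
  next
    case False
    let ?i = "i + d * b"
    have shift_eq: "?i + a - d * (n + b) = i + a - d * n" for a by (simp add: algebra_simps)
    have dbS: "d * b \<in> S" using S_mult[OF gen_mem_S[OF b_mem], of "nat d"] d_pos by simp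
    then have Ap: "?i \<in> Ap S (d * (n + b))"
      using i(2) S_add[OF i(1) dbS] shift_eq[of 0] unfolding Ap_def by (metis (mono_tags, lifting) add.right_neutral mem_Collect_eq)
    have "?i + a - d * (n + b) \<in> S \<or> min_length (?i + a) \<le> min_length ?i" if a: "a \<in> R" for a
    proof -
      have "min_length (i + a + d * b) = min_length (i + a) + nat d"
        using False bounds[OF a] S_add[OF i(1) gen_mem_S[OF a]] by (intro min_length_lift) auto
      moreover have "min_length ?i = min_length i + nat d"
        using False i(1) by (intro min_length_lift) auto
      ultimately show ?thesis using C[OF a] unfolding shift_eq by (simp add: add_ac)
    qed
    then show ?thesis
      using Ap False next_shift.pf_value_mem_PF_iff[OF Ap]
      by (simp add: next_shift.PF_residues_def lift_def)
  qed
qed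

text \<open>Among the low residues, and among the high ones, \<open>pf_value\<close> orders lexicographically by
  \<open>min_length i\<close> and \<open>i\<close>, and \<open>lift\<close> adds constants to these two. A low and a high residue
  stay low and high, and the low one comes first.\<close>

lemma pf_value_lift_less:
  assumes "i \<in> PF_residues" "j \<in> PF_residues" "pf_value i < pf_value j"
  shows "next_shift.pf_value (lift i) < next_shift.pf_value (lift j)"
proof (cases "i < d * n - b \<longleftrightarrow> j < d * n - b")
  case True
  have S: "i \<in> S" "j \<in> S" using assms by (auto simp: PF_residues_def Ap_def)
  have "min_length i < min_length j \<or> min_length i = min_length j \<and> i < j"
    using pf_value_less_iff_residues assms True by blast
  then have "min_length (lift i) < min_length (lift j)
      \<or> min_length (lift i) = min_length (lift j) \<and> lift i < lift j"
    using True S min_length_lift by (auto simp: lift_def)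
  then show ?thesis
    using next_shift.pf_value_less_iff_residues lift_mem_residues assms(1,2) True lift_low_iff
    by blast
next
  case False
  then have "i < d * n - b" "d * n - b \<le> j"
    using pf_value_low_less_high[of j i] assms by fastforce+
  then show ?thesis
    using next_shift.pf_value_low_less_high lift_mem_residues assms(1,2) lift_low_iff
    by (meson not_le)
qed

end

section \<open>Increasing sequences of generators\<close>

locale generator_sequence =
  fixes k :: nat and r :: "nat \<Rightarrow> int"
  assumes k_ge_2: "k \<ge> 2" and r_0: "r 0 = 0" and r_mono: "strict_mono_on {0..k} r"
begin

lemma r_k_ge_2: "2 \<le> r k"
  using strict_mono_onD[OF r_mono, of 0 1] strict_mono_onD[OF r_mono, of 1 k] k_ge_2 r_0 by force

lemma bounded_generators: "bounded_generators (r ` {1..k}) (r k)"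
proof
  show "r k \<in> r ` {1..k}" using k_ge_2 by auto
  show "0 < a \<and> a \<le> r k" if "a \<in> r ` {1..k}" for a
  proof -
    obtain j where "j \<in> {1..k}" "a = r j" using \<open>a \<in> r ` {1..k}\<close> by blast
    then show ?thesis
      using strict_mono_onD[OF r_mono, of 0 j] r_0 strict_mono_on_leD[OF r_mono, of j k] by auto
  qed
qed simp

lemma shifted_generators:
  assumes "2 * (r k)^2 \<le> n" "coprime n (gcd_gens r k)"
  shows "shifted_generators (r ` {1..k}) (r k) n"
  using bounded_generators assms
  by (simp add: shifted_generators_def shifted_generators_axioms_def gcd_gens_def)

lemma coprime_add_r_k: "coprime (n + r k) (gcd_gens r k) \<longleftrightarrow> coprime n (gcd_gens r k)"
proof -
  have "gcd_gens r k dvd r k" using k_ge_2 by (auto simp: gcd_gens_def)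
  then obtain c where "r k = c * gcd_gens r k" by (metis dvd_def mult.commute)
  then have "gcd (gcd_gens r k) (n + r k) = gcd (gcd_gens r k) n"
    using gcd_add_mult[of "gcd_gens r k" c n] by (simp add: add.commute)
  then show ?thesis by (simp add: coprime_iff_gcd_eq_1 gcd.commute)
qed

lemma consecutive_shifts:
  assumes "2 * (r k)^2 \<le> n" "coprime n (gcd_gens r k)"
  shows "consecutive_shifts (r ` {1..k}) (r k) n"
  using assms shifted_generators[of n] shifted_generators[of "n + r k"] r_k_ge_2 coprime_add_r_k[of n]
  by (simp add: consecutive_shifts_def)

lemma M_eq_shift: "M r k n = nat_span ((\<lambda>a. n + a) ` insert 0 (r ` {1..k}))"
proof -
  have "{0..k} = insert 0 {1..k}" by auto
  then have "(\<lambda>j. n + r j) ` {0..k} = (\<lambda>a. n + a) ` insert 0 (r ` {1..k})"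
    using r_0 by (auto simp: image_image)
  then show ?thesis by (simp add: M_def)
qed

lemma P_eq_PF_residues:
  assumes "2 * (r k)^2 \<le> n" "coprime n (gcd_gens r k)"
  shows "P r k n = shifted_generators.PF_residues (r ` {1..k}) n"
proof -
  interpret shifted_generators "r ` {1..k}" "r k" n using shifted_generators[OF assms] .
  show ?thesis
    by (simp only: P_def PF_residues_eq shift_def M_eq_shift S_gens_def gcd_gens_def)
qed

lemma phi_strict_mono:
  assumes "2 * (r k)^2 \<le> n" "coprime n (gcd_gens r k)"
  shows "phi r k n ` PF (M r k n) \<subseteq> PF (M r k (n + r k))"
    and "strict_mono_on (PF (M r k n)) (phi r k n)"
proof -
  interpret consecutive_shifts "r ` {1..k}" "r k" n using consecutive_shifts[OF assms] .
  have M: "M r k n = shift" "M r k (n + r k) = next_shift.shift"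
    by (simp_all only: M_eq_shift shift_def next_shift.shift_def)
  have P: "P r k n = PF_residues" using P_eq_PF_residues[OF assms] .
  have psi: "psi r k n = lift"
    by (intro ext) (simp only: psi_def lift_def gcd_gens_def)
  have residue: "\<exists>i\<in>PF_residues. f = pf_value i" if "f \<in> PF shift" for f
    using obtain_Ap_of_PF[OF that] that unfolding PF_residues_def by blast
  have phi: "phi r k n (pf_value i) = next_shift.pf_value (lift i)" if i: "i \<in> PF_residues" for i
  proof -
    have "j = i" if "j \<in> PF_residues" "[pf_value i = j] (mod n)" for j
    proof (rule Ap_unique)
      show "[j = i] (mod n)" using that(2) pf_value_cong cong_sym cong_trans by blast
    qed (use that i in \<open>simp_all only: PF_residues_def mem_Collect_eq\<close>)
    then have "(THE j. j \<in> PF_residues \<and> [pf_value i = j] (mod n)) = i"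
      using i pf_value_cong by (intro the_equality) blast+
    moreover have "(THE g. g \<in> PF next_shift.shift \<and> [g = lift i] (mod (n + r k)))
        = next_shift.pf_value (lift i)"
      using lift_mem_residues[OF i] next_shift.PF_eq_pf_value next_shift.pf_value_cong
      unfolding next_shift.PF_residues_def by (intro the_equality) auto
    ultimately show ?thesis unfolding phi_def M P psi by simp
  qed
  show "phi r k n ` PF (M r k n) \<subseteq> PF (M r k (n + r k))"
  proof (rule image_subsetI)
    fix f assume "f \<in> PF (M r k n)"
    then obtain i where i: "i \<in> PF_residues" "f = pf_value i" using residue unfolding M by blast
    have "next_shift.pf_value (lift i) \<in> PF next_shift.shift"
      using lift_mem_residues[OF i(1)] unfolding next_shift.PF_residues_def by blast
    then show "phi r k n f \<in> PF (M r k (n + r k))" by (simp only: i(2) phi[OF i(1)] M(2))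
  qed
  show "strict_mono_on (PF (M r k n)) (phi r k n)"
  proof (rule strict_mono_onI)
    fix f g assume "f \<in> PF (M r k n)" "g \<in> PF (M r k n)" "f < g"
    then obtain i j where ij: "i \<in> PF_residues" "f = pf_value i" "j \<in> PF_residues" "g = pf_value j"
      using residue unfolding M by blast
    then have "next_shift.pf_value (lift i) < next_shift.pf_value (lift j)"
      using pf_value_lift_less \<open>f < g\<close> by blast
    then show "phi r k n f < phi r k n g" by (simp only: ij phi)
  qed
qed

text \<open>The inclusion of the image is carried along because the next map is known to increase only
  on pseudo-Frobenius numbers.\<close>

lemma phi_iter_strict_mono:
  assumes "2 * (r k)^2 \<le> n" "coprime n (gcd_gens r k)"
  shows "phi_iter r k n l ` PF (M r k n) \<subseteq> PF (M r k (n + int l * r k))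
    \<and> strict_mono_on (PF (M r k n)) (phi_iter r k n l)"
proof (induction l)
  case 0
  show ?case by (simp add: strict_mono_on_def)
next
  case (Suc l)
  let ?n = "n + int l * r k"
  have "coprime ?n (gcd_gens r k)"
  proof (induction l)
    case (Suc l)
    then show ?case using coprime_add_r_k[of "n + int l * r k"] by (simp add: algebra_simps)
  qed (use assms in simp)
  moreover have "2 * (r k)^2 \<le> ?n"
    using assms(1) r_k_ge_2 mult_nonneg_nonneg[of "int l" "r k"] by linarith
  ultimately have step: "phi r k ?n ` PF (M r k ?n) \<subseteq> PF (M r k (?n + r k))"
    "strict_mono_on (PF (M r k ?n)) (phi r k ?n)"
    using phi_strict_mono[of ?n] by blast+
  have "?n + r k = n + int (Suc l) * r k" by (simp add: algebra_simps)
  moreover have "phi_iter r k n (Suc l) ` PF (M r k n) \<subseteq> PF (M r k (?n + r k))"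
    using Suc step(1) unfolding phi_iter.simps image_comp[symmetric] by blast
  moreover have "strict_mono_on (PF (M r k n)) (phi_iter r k n (Suc l))"
  proof (rule strict_mono_onI)
    fix f g assume fg: "f \<in> PF (M r k n)" "g \<in> PF (M r k n)" "f < g"
    then have "phi_iter r k n l f < phi_iter r k n l g"
      using Suc by (blast intro: strict_mono_onD)
    moreover have "phi_iter r k n l f \<in> PF (M r k ?n)" "phi_iter r k n l g \<in> PF (M r k ?n)"
      using Suc fg by blast+
    ultimately show "phi_iter r k n (Suc l) f < phi_iter r k n (Suc l) g"
      using strict_mono_onD[OF step(2)] by simp
  qed
  ultimately show ?case by metis
qed

lemma P'_before_P'':
  assumes "2 * (r k)^2 \<le> n" "coprime n (gcd_gens r k)"
    and "f \<in> PF (M r k n)" "g \<in> PF (M r k n)" "[f = i] (mod n)" "[g = j] (mod n)"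
    and "i \<in> P' r k n" "j \<in> P'' r k n"
  shows "f < g"
proof -
  interpret shifted_generators "r ` {1..k}" "r k" n using shifted_generators[OF assms(1,2)] .
  have M: "M r k n = shift" by (simp only: M_eq_shift shift_def)
  have P: "P r k n = PF_residues" using P_eq_PF_residues[OF assms(1,2)] .
  have ij: "i \<in> PF_residues" "i < d * n - r k" "j \<in> PF_residues" "d * n - r k \<le> j"
    using assms(7,8) unfolding P'_def P''_def P gcd_gens_def by auto
  then have "f = pf_value i" "g = pf_value j"
    using PF_eq_pf_value assms(3-6) unfolding M PF_residues_def by auto
  then show ?thesis using pf_value_low_less_high[OF ij] by simp
qed

end

theorem proposition2p10:
  fixes k t :: nat and r :: "nat \<Rightarrow> int" and n :: int
    and f i :: "nat \<Rightarrow> int"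
  assumes "k \<ge> 2"
    and "r 0 = 0"
    and "strict_mono_on {0..k} r"
    and "n \<ge> r k ^ 4"
    and "coprime n (gcd_gens r k)"
    and "f ` {1..t} = PF (M r k n)"
    and "strict_mono_on {1..t} f"
    and "\<And>p. p \<in> {1..t} \<Longrightarrow> i p \<in> Ap (S_gens r k) (gcd_gens r k * n) \<and> [f p = i p] (mod n)"
  shows "(\<exists>s\<le>t. \<forall>p\<in>{1..t}. (p \<le> s \<longrightarrow> i p \<in> P' r k n) \<and> (p > s \<longrightarrow> i p \<in> P'' r k n))
    \<and> (\<forall>l. strict_mono_on {1..t} (\<lambda>p. phi_iter r k n l (f p)))"
proof (intro conjI allI)
  interpret generator_sequence k r using assms(1-3) by unfold_locales
  have "2 * (r k)^2 \<le> (r k)^2 * (r k)^2"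
    using power_mono[OF r_k_ge_2, of 2] by (intro mult_right_mono) auto
  also have "\<dots> = r k ^ 4" by (simp flip: power_add)
  finally have n: "2 * (r k)^2 \<le> n" using assms(4) by linarith
  have PF: "f p \<in> PF (M r k n)" if "p \<in> {1..t}" for p using assms(6) that by blast
  have P: "i p \<in> P' r k n \<or> i p \<in> P'' r k n" if "p \<in> {1..t}" for p
    using assms(8)[OF that] PF[OF that] by (auto simp: P'_def P''_def P_def)
  define A where "A = {p \<in> {1..t}. i p \<in> P' r k n}"
  \<comment> \<open>The element 0 makes the maximum meaningful when \<open>P'\<close> contains no \<open>i p\<close>.\<close>
  define s where "s = Max (insert 0 A)"
  have fin: "finite (insert 0 A)" by (simp add: A_def)
  have s: "s \<in> insert 0 A" unfolding s_def using fin by (intro Max_in) auto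
  show "\<exists>s\<le>t. \<forall>p\<in>{1..t}. (p \<le> s \<longrightarrow> i p \<in> P' r k n) \<and> (p > s \<longrightarrow> i p \<in> P'' r k n)"
  proof (intro exI[of _ s] conjI ballI impI)
    show "s \<le> t" using s by (auto simp: A_def)
  next
    fix p assume p: "p \<in> {1..t}" "p \<le> s"
    then have sA: "s \<in> A" using s by auto
    show "i p \<in> P' r k n"
    proof (rule ccontr)
      assume not: "i p \<notin> P' r k n"
      then have "p \<noteq> s" using sA by (auto simp: A_def)
      then have "f p < f s"
        using assms(7) p sA by (auto simp: A_def intro: strict_mono_onD)
      moreover have "f s < f p"
        proof (rule P'_before_P''[OF n assms(5)])
        have "s \<in> {1..t}" using sA by (simp add: A_def)
        then show "f s \<in> PF (M r k n)" "[f s = i s] (mod n)" using PF assms(8) by blast+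
        show "f p \<in> PF (M r k n)" "[f p = i p] (mod n)" using PF assms(8) p(1) by blast+
        show "i s \<in> P' r k n" using sA by (simp add: A_def)
        show "i p \<in> P'' r k n" using P[OF p(1)] not by blast
      qed
      ultimately show False by simp
    qed
  next
    fix p assume p: "p \<in> {1..t}" "p > s"
    then have "p \<notin> A" using Max_ge[OF fin, of p] unfolding s_def by auto
    then show "i p \<in> P'' r k n" using P[OF p(1)] p(1) unfolding A_def by blast
  qed
  show "strict_mono_on {1..t} (\<lambda>p. phi_iter r k n l (f p))" for l
    using phi_iter_strict_mono[OF n assms(5), of l] assms(7) PF
    by (auto simp: strict_mono_on_def)
qed

end
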